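(* Let $\boldsymbol{Q}$ be a real $(d\times d)$ orthogonal matrix. Then $\boldsymbol{Q}$ can be factorized as $\boldsymbol{Q}=\boldsymbol{P}\boldsymbol{L}\boldsymbol{R}^{-1}$, where $\boldsymbol{P}$ is a $(d\times d)$ permutation matrix and $\boldsymbol{L}$ is a $(d\times d)$ unit lower triangular matrix such that $\boldsymbol{Q}=\boldsymbol{P}\boldsymbol{L}\boldsymbol{U}$ for some $(d\times d)$ upper triangular matrix $\boldsymbol{U}$ (a PLU decomposition of $\boldsymbol{Q}$), and $\boldsymbol{R}$ is the upper triangular matrix in the QR decomposition $\boldsymbol{P}\boldsymbol{L}=\widetilde{\boldsymbol{Q}}\boldsymbol{R}$ of the invertible matrix $\boldsymbol{P}\boldsymbol{L}$ (with $\widetilde{\boldsymbol{Q}}$ orthogonal).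
   Context: A unit lower triangular matrix is a lower triangular matrix with all diagonal entries equal to $1$. The paper uses, as given facts, that every invertible $(d\times d)$ real matrix $\boldsymbol{A}$ admits a PLU decomposition $\boldsymbol{A}=\boldsymbol{P}\boldsymbol{L}\boldsymbol{U}$ ($\boldsymbol{P}$ a permutation matrix, $\boldsymbol{L}$ unit lower triangular, $\boldsymbol{U}$ upper triangular), and a QR decomposition $\boldsymbol{A}=\boldsymbol{Q}\boldsymbol{R}$ with $\boldsymbol{Q}$ orthogonal and $\boldsymbol{R}$ upper triangular, which the paper takes to be unique. *)

theory Defs
  imports "HOL-Analysis.Analysis"
begin

text \<open>Square real matrices are indexed by a finite, well-ordered index type 'n
  (so that upper/lower triangularity make sense).\<close>

definition permutation_matrix :: "real^'n^'n \<Rightarrow> bool" where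
  "permutation_matrix P \<longleftrightarrow>
     (\<exists>p. p permutes (UNIV :: 'n set) \<and> P = (\<chi> i j. if j = p i then 1 else 0))"

definition upper_triangular :: "real^('n::{finite,wellorder})^('n::{finite,wellorder}) \<Rightarrow> bool" where
  "upper_triangular A \<longleftrightarrow> (\<forall>i j. j < i \<longrightarrow> A $ i $ j = 0)"

definition unit_lower_triangular :: "real^('n::{finite,wellorder})^('n::{finite,wellorder}) \<Rightarrow> bool" where
  "unit_lower_triangular A \<longleftrightarrow>
     (\<forall>i j. i < j \<longrightarrow> A $ i $ j = 0) \<and> (\<forall>i. A $ i $ i = 1)"

end

theory Submission
  imports Defs
begin

text \<open>Let E_j be the span of the first j standard basis vectors. For invertible A,
  a dimension count lets us pick, for j = 1, ..., d in turn, a vector b_j in A E_j that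
  vanishes at the pivot rows of b_1, ..., b_(j-1) and equals 1 at a new pivot row.
  Ordering rows by pivots, the matrix B with columns b_j is P L with P a permutation
  matrix and L unit lower triangular; and R = A^-1 B is upper triangular because its
  j-th column A^-1 b_j lies in E_j. So A = P L R^-1 is a PLU decomposition, and for
  orthogonal A = Q the identity P L = Q R is itself a QR decomposition of P L.\<close>

lemma matrix_inv:
  fixes A :: "'a::semiring_1^'n^'m"
  assumes "invertible A"
  shows "A ** matrix_inv A = mat 1" "matrix_inv A ** A = mat 1"
proof -
  obtain A' where "A ** A' = mat 1 \<and> A' ** A = mat 1"
    using assms unfolding invertible_def by blast
  then have "A ** matrix_inv A = mat 1 \<and> matrix_inv A ** A = mat 1"
    unfolding matrix_inv_def by (rule someI)
  then show "A ** matrix_inv A = mat 1" "matrix_inv A ** A = mat 1"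
    by auto
qed

lemma invertible_matrix_inv:
  fixes A :: "'a::semiring_1^'n^'m"
  assumes "invertible A"
  shows "invertible (matrix_inv A)"
  using matrix_inv[OF assms] unfolding invertible_def by blast

lemma dim_image_invertible:
  fixes A :: "real^'n^'n"
  assumes "invertible A"
  shows "dim ((*v) A ` S) = dim S"
  using inj_matrix_vector_mult[OF assms]
  by (simp add: dim_image_eq matrix_vector_mul_linear inj_on_def)

definition coordinate_subspace :: "'n set \<Rightarrow> (real^'n) set" where
  "coordinate_subspace d = {x. \<forall>i. i \<notin> d \<longrightarrow> x $ i = 0}"

lemma subspace_coordinate_subspace: "subspace (coordinate_subspace d)"
  using subspace_substandard_cart[where 'a=real and P="\<lambda>i. i \<notin> d"]
  by (simp add: coordinate_subspace_def subspace_vec_eq)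

lemma dim_coordinate_subspace: "dim (coordinate_subspace d) = card d"
  using dim_substandard_cart[where 'a=real and d=d]
  by (simp add: coordinate_subspace_def dim_vec_eq)

lemma axis_in_coordinate_subspace: "j \<in> d \<Longrightarrow> axis j c \<in> coordinate_subspace d"
  by (auto simp: coordinate_subspace_def axis_def)

lemma upper_triangular_iff_column:
  "upper_triangular R \<longleftrightarrow> (\<forall>j. column j R \<in> coordinate_subspace {..j})"
  by (auto simp: upper_triangular_def coordinate_subspace_def column_def)

lemma upper_triangular_mult_coordinate_subspace:
  assumes "upper_triangular R" "x \<in> coordinate_subspace {..j}"
  shows "R *v x \<in> coordinate_subspace {..j}"
proof -
  have "R $ i $ k * x $ k = 0" if "j < i" for i k
  proof (cases "k \<le> j")
    case True
    then show ?thesis using assms(1) \<open>j < i\<close> by (simp add: upper_triangular_def)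
  next
    case False
    then show ?thesis using assms(2) by (simp add: coordinate_subspace_def not_le)
  qed
  then show ?thesis
    by (auto simp: coordinate_subspace_def matrix_vector_mult_def intro!: sum.neutral)
qed

lemma image_coordinate_subspace_upper_triangular:
  assumes "upper_triangular R" "invertible R"
  shows "(*v) R ` coordinate_subspace {..j} = coordinate_subspace {..j}"
proof (rule subspace_dim_equal)
  show "subspace ((*v) R ` coordinate_subspace {..j})"
    by (rule linear_subspace_image[OF matrix_vector_mul_linear subspace_coordinate_subspace])
  show "(*v) R ` coordinate_subspace {..j} \<subseteq> coordinate_subspace {..j}"
    using upper_triangular_mult_coordinate_subspace[OF assms(1)] by auto
  show "dim (coordinate_subspace {..j}) \<le> dim ((*v) R ` coordinate_subspace {..j})"
    by (simp add: dim_image_invertible assms(2))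
qed (rule subspace_coordinate_subspace)

lemma upper_triangular_matrix_inv:
  assumes "upper_triangular R" "invertible R"
  shows "upper_triangular (matrix_inv R)"
  unfolding upper_triangular_iff_column
proof
  fix j
  obtain x where x: "x \<in> coordinate_subspace {..j}" "axis j 1 = R *v x"
    using axis_in_coordinate_subspace[of j "{..j}"]
      image_coordinate_subspace_upper_triangular[OF assms] by blast
  have "column j (matrix_inv R) = (matrix_inv R ** R) *v x"
    by (simp add: matrix_vector_mult_basis[symmetric] x(2) matrix_vector_mul_assoc)
  then show "column j (matrix_inv R) \<in> coordinate_subspace {..j}"
    using x(1) by (simp add: matrix_inv[OF assms(2)])
qed

lemma subspace_nonzero_vanishing_on:
  fixes W :: "(real^'n) set"
  assumes "subspace W" "card K < dim W"
  shows "\<exists>v\<in>W. v \<noteq> 0 \<and> (\<forall>i\<in>K. v $ i = 0)"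
proof -
  let ?Z = "coordinate_subspace (- K)"
  have "card (- K) = CARD('n) - card K"
    by (simp add: Compl_eq_Diff_UNIV card_Diff_subset)
  then have "dim ?Z + card K = CARD('n)"
    by (simp add: dim_coordinate_subspace card_mono)
  moreover have "dim {x + y |x y. x \<in> W \<and> y \<in> ?Z} \<le> CARD('n)"
    by (rule dim_subset_UNIV_cart)
  ultimately have "dim (W \<inter> ?Z) \<noteq> 0"
    using dim_sums_Int[OF assms(1) subspace_coordinate_subspace[of "- K"]] assms(2) by linarith
  then obtain v where "v \<in> W" "v \<in> ?Z" "v \<noteq> 0"
    by (auto simp: dim_eq_0)
  then show ?thesis by (auto simp: coordinate_subspace_def)
qed

lemma exists_permuted_echelon_vectors:
  fixes A :: "real^'n::{finite,wellorder}^'n::{finite,wellorder}"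
  assumes "invertible A" "finite S"
  shows "\<exists>b \<sigma>. inj_on \<sigma> S \<and>
           (\<forall>j\<in>S. b j \<in> (*v) A ` coordinate_subspace {..j} \<and> b j $ \<sigma> j = 1 \<and>
                  (\<forall>i\<in>S. i < j \<longrightarrow> b j $ \<sigma> i = 0))"
  using assms(2)
proof (induction S rule: finite_linorder_max_induct)
  case empty
  then show ?case by auto
next
  case (insert m S)
  then obtain b \<sigma> where inj: "inj_on \<sigma> S" and
    b: "\<forall>j\<in>S. b j \<in> (*v) A ` coordinate_subspace {..j} \<and> b j $ \<sigma> j = 1 \<and>
              (\<forall>i\<in>S. i < j \<longrightarrow> b j $ \<sigma> i = 0)"
    by blast
  let ?W = "(*v) A ` coordinate_subspace {..m}"
  have W: "subspace ?W"
    by (rule linear_subspace_image[OF matrix_vector_mul_linear subspace_coordinate_subspace])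
  have "m \<notin> S" "insert m S \<subseteq> {..m}"
    using insert.hyps(2) by auto
  then have "card S < card {..m}"
    using insert.hyps(1) card_mono[of "{..m}" "insert m S"] by simp
  then have "card (\<sigma> ` S) < dim ?W"
    using card_image[OF inj] by (simp add: dim_image_invertible assms(1) dim_coordinate_subspace)
  then obtain v where v: "v \<in> ?W" "v \<noteq> 0" "\<forall>i\<in>\<sigma> ` S. v $ i = 0"
    using subspace_nonzero_vanishing_on[OF W] by blast
  then obtain r where r: "v $ r \<noteq> 0"
    by (metis vec_eq_iff zero_index)
  with v(3) have "r \<notin> \<sigma> ` S" by auto
  have "(1 / v $ r) *\<^sub>R v \<in> ?W"
    using W v(1) by (rule subspace_scale)
  show ?case
  proof (intro exI conjI ballI impI)
    show "inj_on (\<sigma>(m := r)) (insert m S)"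
      using inj \<open>r \<notin> \<sigma> ` S\<close> \<open>m \<notin> S\<close> by (auto simp: inj_on_def)
  next
    fix j assume j: "j \<in> insert m S"
    let ?b = "b(m := (1 / v $ r) *\<^sub>R v)"
    show "?b j \<in> (*v) A ` coordinate_subspace {..j}"
      using j b \<open>(1 / v $ r) *\<^sub>R v \<in> ?W\<close> by auto
    show "?b j $ (\<sigma>(m := r)) j = 1"
      using j b \<open>m \<notin> S\<close> r by auto
    fix i assume "i \<in> insert m S" "i < j"
    then show "?b j $ (\<sigma>(m := r)) i = 0"
      using j b v(3) insert.hyps(2) by auto
  qed
qed

lemma permutation_matrix_mult:
  "(\<chi> i j. if j = p i then 1 else 0) ** (M :: 'a::semiring_1^'m^'n) = (\<chi> i. M $ p i)"
  by (simp add: matrix_matrix_mult_def vec_eq_iff if_distrib[of "\<lambda>x. x * _"] sum.delta'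
      cong: if_cong)

lemma invertible_permutation_matrix:
  assumes "permutation_matrix P"
  shows "invertible P"
proof -
  obtain p where p: "p permutes UNIV" "P = (\<chi> i j. if j = p i then 1 else 0)"
    using assms unfolding permutation_matrix_def by blast
  then have "P = (\<chi> i. mat 1 $ p i)"
    by (simp add: mat_def vec_eq_iff eq_commute)
  then have "det P = of_int (sign p)"
    using det_permute_rows[OF p(1), of "mat 1"] by simp
  then show ?thesis
    by (simp add: invertible_det_nz sign_def)
qed

lemma invertible_unit_lower_triangular:
  assumes "unit_lower_triangular L"
  shows "invertible L"
proof -
  have "det L = 1"
    using det_lowerdiagonal[of L] assms by (simp add: unit_lower_triangular_def)
  then show ?thesis
    by (simp add: invertible_det_nz)
qed

lemma exists_permuted_unit_lower_eq_mult_upper: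
  fixes A :: "real^'n::{finite,wellorder}^'n::{finite,wellorder}"
  assumes "invertible A"
  shows "\<exists>P L R. permutation_matrix P \<and> unit_lower_triangular L \<and>
           upper_triangular R \<and> invertible R \<and> P ** L = A ** R"
proof -
  obtain b \<sigma> where "inj \<sigma>" and
    b: "\<And>j. b j \<in> (*v) A ` coordinate_subspace {..j}" "\<And>j. b j $ \<sigma> j = 1"
       "\<And>i j. i < j \<Longrightarrow> b j $ \<sigma> i = 0"
    using exists_permuted_echelon_vectors[OF assms, of UNIV] by auto
  have \<sigma>: "\<sigma> permutes UNIV"
    using \<open>inj \<sigma>\<close> by (auto intro: inj_imp_permutes)
  define B :: "real^'n::{finite,wellorder}^'n::{finite,wellorder}"
    where "B = (\<chi> i j. b j $ i)"
  define P :: "real^'n::{finite,wellorder}^'n::{finite,wellorder}"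
    where "P = (\<chi> i j. if j = inv \<sigma> i then 1 else 0)"
  define L :: "real^'n::{finite,wellorder}^'n::{finite,wellorder}"
    where "L = (\<chi> k j. b j $ \<sigma> k)"
  define R where "R = matrix_inv A ** B"
  have P: "permutation_matrix P"
    unfolding permutation_matrix_def P_def using permutes_inv[OF \<sigma>] by blast
  moreover have L: "unit_lower_triangular L"
    using b by (simp add: unit_lower_triangular_def L_def)
  moreover have PL: "P ** L = B"
    by (simp add: P_def L_def B_def permutation_matrix_mult permutes_inverses(1)[OF \<sigma>])
  moreover have "A ** R = B"
    by (simp add: R_def matrix_mul_assoc matrix_inv[OF assms])
  moreover have "upper_triangular R"
    unfolding upper_triangular_iff_column
  proof
    fix j
    obtain x where x: "x \<in> coordinate_subspace {..j}" "b j = A *v x"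
      using b(1) by blast
    have "column j R = matrix_inv A *v b j"
      by (simp add: R_def B_def column_def matrix_matrix_mult_def matrix_vector_mult_def)
    also have "\<dots> = x"
      by (simp add: x(2) matrix_vector_mul_assoc matrix_inv[OF assms])
    finally show "column j R \<in> coordinate_subspace {..j}"
      using x(1) by simp
  qed
  moreover have "invertible R"
    unfolding R_def PL[symmetric]
    using invertible_matrix_inv[OF assms] invertible_permutation_matrix[OF P]
      invertible_unit_lower_triangular[OF L]
    by (intro invertible_mult)
  ultimately show ?thesis by metis
qed

theorem theorem1:
  fixes Q :: "real^('n::{finite,wellorder})^('n::{finite,wellorder})"
  assumes "orthogonal_matrix Q"
  shows "\<exists>P L U Qt R.
           permutation_matrix P \<and> unit_lower_triangular L \<and> upper_triangular U \<and>
           Q = P ** L ** U \<and>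
           invertible (P ** L) \<and>
           orthogonal_matrix Qt \<and> upper_triangular R \<and> P ** L = Qt ** R \<and>
           invertible R \<and>
           Q = P ** L ** matrix_inv R"
proof -
  have "invertible Q"
    using assms unfolding orthogonal_matrix_def invertible_def by blast
  then obtain P L R where P: "permutation_matrix P" and L: "unit_lower_triangular L" and
    R: "upper_triangular R" "invertible R" and PL: "P ** L = Q ** R"
    using exists_permuted_unit_lower_eq_mult_upper by blast
  have "Q = P ** L ** matrix_inv R"
    by (simp add: PL matrix_mul_assoc[symmetric] matrix_inv[OF R(2)])
  moreover have "invertible (P ** L)"
    using P L
    by (simp add: invertible_mult invertible_permutation_matrix invertible_unit_lower_triangular)
  moreover have "upper_triangular (matrix_inv R)"
    using R by (rule upper_triangular_matrix_inv)
  ultimately show ?thesis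
    using P L R PL assms by blast
qed

end
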